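(* Let $A, E, F\in\mathbb{C}^{n\times n}$ with $E$ and $F$ invertible and Hermitian. Then the generalized weighted Moore-Penrose inverse $A^\dagger_{E,F}$ exists if and only if $$AF^{-1}A^*EAY=A=ZAF^{-1}A^*EA$$ for some $Y\in\mathbb{C}^{n\times n}$ and $Z\in\mathbb{C}^{n\times n}$.
   Context: $A^*$ is the conjugate transpose of $A$. The generalized weighted Moore-Penrose inverse $A^\dagger_{E,F}$ is the matrix $X$, unique when it exists, with $AXA=A$, $XAX=X$, $(EAX)^*=EAX$, $(FXA)^*=FXA$. *)

theory Defs
  imports "HOL-Analysis.Analysis"
begin

definition conj_transpose :: "complex^'n^'m \<Rightarrow> complex^'m^'n"
  where "conj_transpose A = (\<chi> i j. cnj (A $ j $ i))"

definition hermitian_matrix :: "complex^'n^'n \<Rightarrow> bool"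
  where "hermitian_matrix A \<longleftrightarrow> conj_transpose A = A"

(* E and F are not required to be positive definite here, so an X with this
   property need not exist; for invertible Hermitian E and F there is at most one. *)
definition is_gen_weighted_MP_inverse ::
    "complex^'n^'n \<Rightarrow> complex^'n^'n \<Rightarrow> complex^'n^'n \<Rightarrow> complex^'n^'n \<Rightarrow> bool"
  where "is_gen_weighted_MP_inverse E F A X \<longleftrightarrow>
    A ** X ** A = A \<and>
    X ** A ** X = X \<and>
    conj_transpose (E ** A ** X) = E ** A ** X \<and>
    conj_transpose (F ** X ** A) = F ** X ** A"

end

(* Take adjoints with respect to the indefinite forms given by E and F: A^# = F^{-1} A^* E,
   Y^# = F^{-1} Y^* F, Z^# = E^{-1} Z^* E.  With B = A^# the condition reads A B A Y = A = Z A B A.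
   Given X, the matrices Y = X E^{-1} X^* F and Z = E^{-1} X^* F X work.  Conversely, taking adjoints
   gives B = Y^# B A B = B A B Z^#, so Y^# B = Y^# B A B Z^# = B Z^#, and this common value is the
   generalized inverse: the form B Z^# makes A X self-adjoint, while Y^# B makes X A so. *)

theory Submission
  imports Defs
begin

lemma
  fixes A :: "'a::semiring_1^'n^'m"
  assumes "invertible A"
  shows matrix_inv_right: "A ** matrix_inv A = mat 1"
    and matrix_inv_left: "matrix_inv A ** A = mat 1"
  using someI_ex[OF assms[unfolded invertible_def]] by (simp_all add: matrix_inv_def)

lemma conj_transpose_mult:
  "conj_transpose (A ** B) = conj_transpose B ** conj_transpose A"
  by (simp add: conj_transpose_def matrix_matrix_mult_def vec_eq_iff mult.commute)

lemma conj_transpose_conj_transpose [simp]: "conj_transpose (conj_transpose A) = A"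
  by (simp add: conj_transpose_def vec_eq_iff)

lemma conj_transpose_mat_1 [simp]: "conj_transpose (mat 1) = mat 1"
  by (simp add: conj_transpose_def mat_def vec_eq_iff)

text \<open>Taking adjoints in \<open>F ** matrix_inv F = mat 1\<close> produces a left inverse of
  \<open>F\<close>, which must agree with the right inverse.\<close>

lemma conj_transpose_matrix_inv:
  assumes "invertible F" and "hermitian_matrix F"
  shows "conj_transpose (matrix_inv F) = matrix_inv F"
proof -
  have "F ** matrix_inv F = mat 1"
    using assms(1) by (rule matrix_inv_right)
  then have "conj_transpose (F ** matrix_inv F) = mat 1"
    by simp
  then have left: "conj_transpose (matrix_inv F) ** F = mat 1"
    using assms(2) by (simp add: conj_transpose_mult hermitian_matrix_def)
  have "conj_transpose (matrix_inv F) = conj_transpose (matrix_inv F) ** (F ** matrix_inv F)"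
    by (simp add: matrix_inv_right assms(1))
  also have "\<dots> = matrix_inv F"
    by (simp add: matrix_mul_assoc left)
  finally show ?thesis .
qed

text \<open>With X^# = E^{-1} X^* F the witnesses are Y = X X^# and Z = X^# X. One factor X is
  absorbed by A^# A X = A^# = X A A^#; the weighted symmetry of X A or A X then turns the rest into
  A X A.\<close>

lemma gen_weighted_MP_inverse_imp_factorizations:
  fixes A E F X :: "complex^'n^'n"
  assumes "invertible E" and "hermitian_matrix E"
    and "invertible F" and "hermitian_matrix F"
    and X: "is_gen_weighted_MP_inverse E F A X"
  defines "Y \<equiv> X ** matrix_inv E ** conj_transpose X ** F"
    and "Z \<equiv> matrix_inv E ** conj_transpose X ** F ** X"
  shows "A ** matrix_inv F ** conj_transpose A ** E ** A ** Y = A"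
    and "Z ** A ** matrix_inv F ** conj_transpose A ** E ** A = A"
proof -
  let ?A = "conj_transpose A" and ?X = "conj_transpose X"
  let ?E = "matrix_inv E" and ?F = "matrix_inv F"
  have EE: "E ** ?E = mat 1" "?E ** E = mat 1" and FF: "F ** ?F = mat 1" "?F ** F = mat 1"
    using assms by (simp_all add: matrix_inv_right matrix_inv_left)
  have AXA: "A ** X ** A = A" and EAX: "?X ** ?A ** E = E ** A ** X"
    and FXA: "?A ** ?X ** F = F ** X ** A"
    using X assms(2,4)
    by (simp_all add: is_gen_weighted_MP_inverse_def conj_transpose_mult hermitian_matrix_def
        matrix_mul_assoc)
  have AXA': "?A ** ?X ** ?A = ?A"
    using arg_cong[OF AXA, of conj_transpose] by (simp add: conj_transpose_mult matrix_mul_assoc)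
  have "?A ** E ** A ** X = ?A ** (E ** A ** X)"
    by (simp add: matrix_mul_assoc)
  also have "\<dots> = ?A ** ?X ** ?A ** E"
    by (simp add: matrix_mul_assoc flip: EAX)
  \<comment> \<open>This is A^# A X = A^# without its left factor F^{-1}; \<open>A2\<close> encodes
    the mirror identity X A A^# = A^#.\<close>
  finally have A1: "?A ** E ** A ** X = ?A ** E"
    by (simp add: AXA')
  have "F ** X ** A ** ?F ** ?A = ?A ** ?X ** (F ** ?F) ** ?A"
    by (simp add: matrix_mul_assoc flip: FXA)
  then have A2: "F ** X ** A ** ?F ** ?A = ?A"
    by (simp add: FF AXA')
  have "A ** ?F ** ?A ** E ** A ** Y = A ** ?F ** (?A ** E ** A ** X) ** ?E ** ?X ** F"
    by (simp add: Y_def matrix_mul_assoc)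
  also have "\<dots> = A ** ?F ** ?A ** (E ** ?E) ** ?X ** F"
    unfolding A1 by (simp add: matrix_mul_assoc)
  also have "\<dots> = A ** ?F ** (?A ** ?X ** F)"
    by (simp add: EE matrix_mul_assoc)
  also have "\<dots> = A ** (?F ** F) ** X ** A"
    unfolding FXA by (simp add: matrix_mul_assoc)
  finally show "A ** ?F ** ?A ** E ** A ** Y = A"
    by (simp add: FF AXA)
  have "Z ** A ** ?F ** ?A ** E ** A = ?E ** ?X ** (F ** X ** A ** ?F ** ?A) ** E ** A"
    by (simp add: Z_def matrix_mul_assoc)
  also have "\<dots> = ?E ** (?X ** ?A ** E) ** A"
    unfolding A2 by (simp add: matrix_mul_assoc)
  also have "\<dots> = (?E ** E) ** (A ** X ** A)"
    unfolding EAX by (simp add: matrix_mul_assoc)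
  finally show "Z ** A ** ?F ** ?A ** E ** A = A"
    by (simp add: EE AXA)
qed

text \<open>The witness is B Z^# with the inner E E^{-1} cancelled; \<open>X_eq\<close> rewrites it
  as Y^# B with F F^{-1} cancelled.\<close>

lemma factorizations_imp_gen_weighted_MP_inverse:
  fixes A E F Y Z :: "complex^'n^'n"
  assumes "hermitian_matrix E" and "invertible F" and "hermitian_matrix F"
    and Y: "A ** matrix_inv F ** conj_transpose A ** E ** A ** Y = A"
    and Z: "Z ** A ** matrix_inv F ** conj_transpose A ** E ** A = A"
  shows "is_gen_weighted_MP_inverse E F A (matrix_inv F ** conj_transpose A ** conj_transpose Z ** E)"
proof -
  let ?A = "conj_transpose A" and ?Y = "conj_transpose Y" and ?Z = "conj_transpose Z"
  let ?F = "matrix_inv F"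
  let ?X = "?F ** ?A ** ?Z ** E"
  have FF: "F ** ?F = mat 1"
    using assms by (simp add: matrix_inv_right)
  have herm: "conj_transpose E = E" "conj_transpose F = F" "conj_transpose ?F = ?F"
    using assms by (simp_all add: hermitian_matrix_def conj_transpose_matrix_inv)
  note adj = conj_transpose_mult herm matrix_mul_assoc
  have Y': "?Y ** ?A ** E ** A ** ?F ** ?A = ?A"
    using arg_cong[OF Y, of conj_transpose] by (simp add: adj)
  have Z': "?A ** E ** A ** ?F ** ?A ** ?Z = ?A"
    using arg_cong[OF Z, of conj_transpose] by (simp add: adj)
  \<comment> \<open>The product Y^* A^* E A F^{-1} A^* Z^* collapses from the left by
    \<open>Y'\<close> and from the right by \<open>Z'\<close>.\<close>
  have AZ: "?A ** ?Z = ?Y ** ?A"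
  proof -
    have "?A ** ?Z = ?Y ** (?A ** E ** A ** ?F ** ?A ** ?Z)"
      using Y' by (simp add: matrix_mul_assoc)
    then show ?thesis
      by (simp only: Z')
  qed
  have X_eq: "?X = ?F ** ?Y ** ?A ** E"
    using arg_cong[OF AZ, of "\<lambda>M. ?F ** M ** E"] unfolding matrix_mul_assoc by simp
  \<comment> \<open>Expanding the first A by \<open>Z\<close> gives (E Z) H (E Z)^* with H = A
    F^{-1} A^* E A F^{-1} A^* Hermitian, so symmetry can be read off.\<close>
  have EAX_eq: "E ** A ** ?X = E ** Z ** A ** ?F ** ?A ** E ** A ** ?F ** ?A ** ?Z ** E"
    using arg_cong[OF Z, of "\<lambda>M. E ** M ** ?X"] unfolding matrix_mul_assoc by (rule sym)
  have EAX: "conj_transpose (E ** A ** ?X) = E ** A ** ?X"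
    unfolding EAX_eq by (simp add: adj)
  have FX: "F ** ?X ** A = ?Y ** ?A ** E ** A"
    unfolding X_eq by (simp add: matrix_mul_assoc FF)
  \<comment> \<open>Expanding the last A by \<open>Y\<close> similarly gives Y^* K Y with K = A^* E
    A F^{-1} A^* E A Hermitian.\<close>
  also have "\<dots> = ?Y ** ?A ** E ** A ** ?F ** ?A ** E ** A ** Y"
    using arg_cong[OF Y, of "\<lambda>M. ?Y ** ?A ** E ** M"] unfolding matrix_mul_assoc by (rule sym)
  finally have FXA_eq: "F ** ?X ** A = ?Y ** ?A ** E ** A ** ?F ** ?A ** E ** A ** Y" .
  have FXA: "conj_transpose (F ** ?X ** A) = F ** ?X ** A"
    unfolding FXA_eq by (simp add: adj)
  \<comment> \<open>The symmetry of F X A in its short form \<open>FX\<close> moves Y to the right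
    end, where the hypothesis \<open>Y\<close> applies.\<close>
  have YAEA: "?Y ** ?A ** E ** A = ?A ** E ** A ** Y"
    using FXA unfolding FX by (simp add: adj)
  have "A ** ?X ** A = A ** ?F ** (?Y ** ?A ** E ** A)"
    unfolding X_eq by (simp add: matrix_mul_assoc)
  also have "\<dots> = A"
    unfolding YAEA using Y by (simp add: matrix_mul_assoc)
  finally have AXA: "A ** ?X ** A = A" .
  \<comment> \<open>Only the left factor takes its Y form, so that the block in \<open>Y'\<close>
    appears in the middle.\<close>
  have "?X ** A ** ?X = ?F ** (?Y ** ?A ** E ** A ** ?F ** ?A) ** ?Z ** E"
    by (subst (1) X_eq) (simp add: matrix_mul_assoc)
  then have XAX: "?X ** A ** ?X = ?X"
    by (simp only: Y')
  show ?thesis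
    unfolding is_gen_weighted_MP_inverse_def using AXA XAX EAX FXA by blast
qed

theorem theorem3p33:
  fixes A E F :: "complex^'n^'n"
  assumes "invertible E" and "hermitian_matrix E"
    and "invertible F" and "hermitian_matrix F"
  shows "(\<exists>X. is_gen_weighted_MP_inverse E F A X) \<longleftrightarrow>
    (\<exists>Y Z :: complex^'n^'n.
      A ** matrix_inv F ** conj_transpose A ** E ** A ** Y = A \<and>
      A = Z ** A ** matrix_inv F ** conj_transpose A ** E ** A)"
proof
  assume "\<exists>X. is_gen_weighted_MP_inverse E F A X"
  then obtain X where "is_gen_weighted_MP_inverse E F A X" ..
  from gen_weighted_MP_inverse_imp_factorizations[OF assms this]
  show "\<exists>Y Z. A ** matrix_inv F ** conj_transpose A ** E ** A ** Y = A \<and>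
      A = Z ** A ** matrix_inv F ** conj_transpose A ** E ** A"
    by (intro exI conjI) (assumption, rule sym)
next
  assume "\<exists>Y Z. A ** matrix_inv F ** conj_transpose A ** E ** A ** Y = A \<and>
      A = Z ** A ** matrix_inv F ** conj_transpose A ** E ** A"
  then obtain Y Z where "A ** matrix_inv F ** conj_transpose A ** E ** A ** Y = A"
    and "A = Z ** A ** matrix_inv F ** conj_transpose A ** E ** A"
    by (elim exE conjE)
  from factorizations_imp_gen_weighted_MP_inverse[OF assms(2-4) this(1) this(2)[symmetric]]
  show "\<exists>X. is_gen_weighted_MP_inverse E F A X" ..
qed

end
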